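(* Let $G=(V,E)$ be a connected graph with $V=\{1,\dots,N\}$, $E\subset\{(n,m)\in V\times V: n<m\}$, $M=|E|$, let $w\in\mathbb{R}^N$ and $\lambda\in\mathbb{R}^M$ have positive entries, and let $y=(y_n)_{n\in V}\in\mathbb{C}^N$ with $|y_n|=1$ for all $n$. Consider the two convex problems $$\text{(A)}\quad \operatorname*{arg\,min}_{x\in\mathbb{C}^N,\ r\in\mathbb{C}^M}\ \mathcal J(x,r)\quad\text{s.t.}\quad P_{(n,m)}\succeq 0\ \text{ for all }(n,m)\in E,$$ $$\text{(B)}\quad \operatorname*{arg\,min}_{\boldsymbol x\in(\mathbb{R}^2)^N,\ \boldsymbol \ell\in\mathbb{R}^M}\ \mathcal K(\boldsymbol x,\boldsymbol \ell)\quad\text{s.t.}\quad \boldsymbol Q_{(n,m)}\succeq 0\ \text{ for all }(n,m)\in E,$$ where $\mathcal J,\mathcal K,P_{(n,m)},\boldsymbol Q_{(n,m)}$ are as defined in the context, and where complex numbers $z$ are identified with vectors $\boldsymbol z=(\operatorname{Re}[z],\operatorname{Im}[z])^{\mathrm T}\in\mathbb{R}^2$. These problems are equivalent in the following sense: (i) If $(\hat x,\hat r)$ solves (A), then $(\hat{\boldsymbol x},\operatorname{Re}[\hat r])$ solves (B), where $\hat{\boldsymbol x}_n=(\operatorname{Re}[\hat x_n],\operatorname{Im}[\hat x_n])^{\mathrm T}$ and $\operatorname{Re}$ is taken componentwise. (ii) If $(\tilde{\boldsymbol x},\tilde{\boldsymbol\ell})$ solves (B), then $(\tilde x,\tilde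 r)$ solves (A), where $\tilde x_n\in\mathbb{C}$ is the complex number identified with $\tilde{\boldsymbol x}_n$ and $\tilde r_{(n,m)}=\tilde{\boldsymbol\ell}_{(n,m)}+\mathrm i\,\operatorname{Im}[\overline{\tilde x}_m\tilde x_n]$ for all $(n,m)\in E$.
   Context: "Solves" means "is a minimizer of". $\succeq0$ means Hermitian (respectively symmetric) positive semi-definite; $\boldsymbol I_2$ is the $2\times 2$ identity; $\langle\cdot,\cdot\rangle$ is the Euclidean inner product. With $\boldsymbol y_n=(\operatorname{Re}[y_n],\operatorname{Im}[y_n])^{\mathrm T}$, the objectives are $$\mathcal J(x,r)=-\sum_{n\in V}w_n\operatorname{Re}[x_n\bar y_n]-\sum_{(n,m)\in E}\lambda_{(n,m)}\operatorname{Re}[r_{(n,m)}],$$ $$\mathcal K(\boldsymbol x,\boldsymbol\ell)=-\sum_{n\in V}w_n\langle\boldsymbol x_n,\boldsymbol y_n\rangle-\sum_{(n,m)\in E}\lambda_{(n,m)}\boldsymbol\ell_{(n,m)},$$ and the matrices are $$P_{(n,m)}=\begin{bmatrix}1&x_n&x_m\\ \bar x_n&1&\bar r_{(n,m)}\\ \bar x_m&r_{(n,m)}&1\end{bmatrix}\in\mathbb{C}^{3\times3},\qquad \boldsymbol Q_{(n,m)}=\begin{bmatrix}\boldsymbol I_2&\boldsymbol x_n&\boldsymbol x_m\\ \boldsymbol x_n^{\mathrm T}&1&\boldsymbol\ell_{(n,m)}\\ \boldsymbol x_m^{\mathrm T}&\boldsymbol\ell_{(n,m)}&1\end{bmatrix}\in\mathbb{R}^{4\times4}.$$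 *)

theory Defs
  imports
    "HOL-Analysis.Analysis"
    "Graph_Theory.Digraph_Component"
    "Graph_Theory.Pair_Digraph"
begin

(* The graph with edge set E of pairs (n, m), n < m, is undirected: "connected" from
   Graph_Theory is connectedness of the symmetric closure. The full name is needed since
   HOL-Analysis uses the same short name for topological connectedness. *)
definition connected_graph :: "nat set \<Rightarrow> (nat \<times> nat) set \<Rightarrow> bool" where
  "connected_graph V E \<longleftrightarrow>
     Digraph_Component.connected (with_proj \<lparr>pverts = V, parcs = E\<rparr>)"

definition to_vec :: "complex \<Rightarrow> real ^ 2" where
  "to_vec z = vector [Re z, Im z]"

definition to_complex :: "real ^ 2 \<Rightarrow> complex" where
  "to_complex v = Complex (v $ 1) (v $ 2)"

definition conj_transpose :: "complex ^ 'n ^ 'm \<Rightarrow> complex ^ 'm ^ 'n" where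
  "conj_transpose A = (\<chi> i j. cnj (A $ j $ i))"

(* For Hermitian A the quadratic form is real, so taking its real part loses nothing. *)
definition hermitian_psd :: "complex ^ 'n ^ 'n \<Rightarrow> bool" where
  "hermitian_psd A \<longleftrightarrow> conj_transpose A = A \<and>
     (\<forall>v. 0 \<le> Re (\<Sum>i\<in>UNIV. cnj (v $ i) * (A *v v) $ i))"

definition symmetric_psd :: "real ^ 'n ^ 'n \<Rightarrow> bool" where
  "symmetric_psd A \<longleftrightarrow> transpose A = A \<and> (\<forall>v. 0 \<le> v \<bullet> (A *v v))"

(* Elements of C^N, C^M, (R^2)^N and R^M are extensional functions on the index sets V and E. *)

definition P_mat ::
    "(nat \<Rightarrow> complex) \<Rightarrow> (nat \<times> nat \<Rightarrow> complex) \<Rightarrow> nat \<times> nat \<Rightarrow> complex ^ 3 ^ 3" where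
  "P_mat x r = (\<lambda>(n, m). vector
     [vector [1,         x n,      x m],
      vector [cnj (x n), 1,        cnj (r (n, m))],
      vector [cnj (x m), r (n, m), 1]])"

definition Q_mat ::
    "(nat \<Rightarrow> real ^ 2) \<Rightarrow> (nat \<times> nat \<Rightarrow> real) \<Rightarrow> nat \<times> nat \<Rightarrow> real ^ 4 ^ 4" where
  "Q_mat x l = (\<lambda>(n, m). vector
     [vector [1,       0,       x n $ 1,  x m $ 1],
      vector [0,       1,       x n $ 2,  x m $ 2],
      vector [x n $ 1, x n $ 2, 1,        l (n, m)],
      vector [x m $ 1, x m $ 2, l (n, m), 1]])"

definition obj_J ::
    "nat set \<Rightarrow> (nat \<times> nat) set \<Rightarrow> (nat \<Rightarrow> real) \<Rightarrow> (nat \<times> nat \<Rightarrow> real) \<Rightarrow> (nat \<Rightarrow> complex)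
      \<Rightarrow> (nat \<Rightarrow> complex) \<times> (nat \<times> nat \<Rightarrow> complex) \<Rightarrow> real" where
  "obj_J V E w lam y = (\<lambda>(x, r).
     - (\<Sum>n\<in>V. w n * Re (x n * cnj (y n))) - (\<Sum>e\<in>E. lam e * Re (r e)))"

definition obj_K ::
    "nat set \<Rightarrow> (nat \<times> nat) set \<Rightarrow> (nat \<Rightarrow> real) \<Rightarrow> (nat \<times> nat \<Rightarrow> real) \<Rightarrow> (nat \<Rightarrow> complex)
      \<Rightarrow> (nat \<Rightarrow> real ^ 2) \<times> (nat \<times> nat \<Rightarrow> real) \<Rightarrow> real" where
  "obj_K V E w lam y = (\<lambda>(x, l).
     - (\<Sum>n\<in>V. w n * (x n \<bullet> to_vec (y n))) - (\<Sum>e\<in>E. lam e * l e))"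

definition feasible_A ::
    "nat set \<Rightarrow> (nat \<times> nat) set \<Rightarrow> ((nat \<Rightarrow> complex) \<times> (nat \<times> nat \<Rightarrow> complex)) set" where
  "feasible_A V E =
     {(x, r). x \<in> (V \<rightarrow>\<^sub>E UNIV) \<and> r \<in> (E \<rightarrow>\<^sub>E UNIV) \<and> (\<forall>e\<in>E. hermitian_psd (P_mat x r e))}"

definition feasible_B ::
    "nat set \<Rightarrow> (nat \<times> nat) set \<Rightarrow> ((nat \<Rightarrow> real ^ 2) \<times> (nat \<times> nat \<Rightarrow> real)) set" where
  "feasible_B V E =
     {(x, l). x \<in> (V \<rightarrow>\<^sub>E UNIV) \<and> l \<in> (E \<rightarrow>\<^sub>E UNIV) \<and> (\<forall>e\<in>E. symmetric_psd (Q_mat x l e))}"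

definition solves_A where
  "solves_A V E w lam y p \<longleftrightarrow> is_arg_min (obj_J V E w lam y) (\<lambda>q. q \<in> feasible_A V E) p"

definition solves_B where
  "solves_B V E w lam y p \<longleftrightarrow> is_arg_min (obj_K V E w lam y) (\<lambda>q. q \<in> feasible_B V E) p"

end

(* Eliminating the first block row by a Schur complement turns both constraints into conditions
   on 1 - |x_n|^2, 1 - |x_m|^2 and an off-diagonal defect: r - x_n cnj (x_m) for P and its
   real part for Q. Hence P >= 0 implies Q >= 0 with l = Re r, and choosing Im r so that the defect
   is real gives the converse. The two correspondences preserve the objective values. *)

theory Submission
  imports Defs
begin

lemma vector_4:
  fixes a b c d :: "'a::zero"
  shows "(vector [a, b, c, d] :: 'a ^ 4) $ 1 = a" "(vector [a, b, c, d] :: 'a ^ 4) $ 2 = b"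
    "(vector [a, b, c, d] :: 'a ^ 4) $ 3 = c" "(vector [a, b, c, d] :: 'a ^ 4) $ 4 = d"
  by (simp_all add: vector_def)

text \<open>The chain g q \<le> f p \<le> f (h z) \<le> g z bounds every competitor z from below. No
  inverse of \<open>h\<close> enters.\<close>

lemma is_arg_min_transfer:
  fixes f :: "'a \<Rightarrow> 'c::linorder" and g :: "'b \<Rightarrow> 'c"
  assumes "is_arg_min f P p" "Q q" "g q \<le> f p"
    and "\<And>z. Q z \<Longrightarrow> P (h z) \<and> f (h z) \<le> g z"
  shows "is_arg_min g Q q"
  using assms unfolding is_arg_min_def by (meson leD le_less_trans order_trans not_le)

lemma Re_to_complex_mult_cnj: "Re (to_complex u * cnj z) = u \<bullet> to_vec z"
  by (simp add: to_complex_def to_vec_def inner_vec_def sum_2)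

lemma to_vec_inner: "to_vec z \<bullet> to_vec y = Re (z * cnj y)"
  by (simp add: to_vec_def inner_vec_def sum_2)

text \<open>Completing the square in the coordinates of the identity block leaves the quadratic form
  of its Schur complement.\<close>

lemma Q_form:
  "u \<bullet> (Q_mat x l (n, m) *v u) =
     (u $ 1 + x n $ 1 * u $ 3 + x m $ 1 * u $ 4)\<^sup>2 + (u $ 2 + x n $ 2 * u $ 3 + x m $ 2 * u $ 4)\<^sup>2 +
     (1 - x n \<bullet> x n) * (u $ 3)\<^sup>2 + (1 - x m \<bullet> x m) * (u $ 4)\<^sup>2 +
     2 * (l (n, m) - x n \<bullet> x m) * u $ 3 * u $ 4"
  by (simp add: Q_mat_def inner_vec_def matrix_vector_mult_def sum_2 sum_4 vector_4
      power2_eq_square algebra_simps)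

text \<open>The complex counterpart, with the entry 1 in the top left corner as pivot.\<close>

lemma P_form:
  "Re (\<Sum>i\<in>UNIV. cnj (v $ i) * (P_mat x r (n, m) *v v) $ i) =
     (cmod (v $ 1 + x n * v $ 2 + x m * v $ 3))\<^sup>2 +
     (1 - (cmod (x n))\<^sup>2) * (cmod (v $ 2))\<^sup>2 + (1 - (cmod (x m))\<^sup>2) * (cmod (v $ 3))\<^sup>2 +
     2 * Re ((r (n, m) - x n * cnj (x m)) * v $ 2 * cnj (v $ 3))"
  unfolding cmod_power2
  by (simp add: P_mat_def matrix_vector_mult_def sum_3 vector_3 power2_eq_square algebra_simps)

lemma transpose_Q_mat: "transpose (Q_mat x l e) = Q_mat x l e"
  by (cases e) (simp add: Q_mat_def transpose_def vec_eq_iff forall_4 vector_4)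

lemma conj_transpose_P_mat: "conj_transpose (P_mat x r e) = P_mat x r e"
  by (cases e) (simp add: P_mat_def conj_transpose_def vec_eq_iff forall_3 vector_3)

text \<open>The form of Q is that of P restricted to vectors in C x R x R, with R^2 read as C in the
  first slot. With real last entries only the real part of the defect is seen.\<close>

lemma symmetric_psd_Q_mat_of_P_mat:
  assumes P: "hermitian_psd (P_mat x r (n, m))"
    and x': "x' n = to_vec (x n)" "x' m = to_vec (x m)" and l: "l (n, m) = Re (r (n, m))"
  shows "symmetric_psd (Q_mat x' l (n, m))"
proof -
  have "0 \<le> u \<bullet> (Q_mat x' l (n, m) *v u)" for u
  proof -
    define v :: "complex ^ 3"
      where "v = vector [Complex (u $ 1) (u $ 2), of_real (u $ 3), of_real (u $ 4)]"
    have "u \<bullet> (Q_mat x' l (n, m) *v u) =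
        Re (\<Sum>i\<in>UNIV. cnj (v $ i) * (P_mat x r (n, m) *v v) $ i)"
      unfolding P_form Q_form cmod_power2 x' l to_vec_inner
      by (simp add: v_def vector_3 to_vec_def vector_2 power2_eq_square algebra_simps)
    then show ?thesis
      using P by (simp add: hermitian_psd_def)
  qed
  then show ?thesis
    by (simp add: symmetric_psd_def transpose_Q_mat)
qed

lemma hermitian_psd_P_mat_of_Q_mat:
  assumes Q: "symmetric_psd (Q_mat x l (n, m))"
    and x': "x' n = to_complex (x n)" "x' m = to_complex (x m)"
    and r: "r (n, m) = Complex (l (n, m)) (Im (cnj (x' m) * x' n))"
  shows "hermitian_psd (P_mat x' r (n, m))"
proof -
  \<comment> \<open>The Schur complement form of Q, with the real defect off the diagonal.\<close>
  define S where "S c d = (1 - x n \<bullet> x n) * c\<^sup>2 + (1 - x m \<bullet> x m) * d\<^sup>2 +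
    2 * (l (n, m) - x n \<bullet> x m) * c * d" for c d
  have S: "0 \<le> S c d" for c d
  proof -
    \<comment> \<open>The first two entries make both squares in \<open>Q_form\<close>
      vanish.\<close>
    define u :: "real ^ 4"
      where "u = vector [- (x n $ 1 * c + x m $ 1 * d), - (x n $ 2 * c + x m $ 2 * d), c, d]"
    have "S c d = u \<bullet> (Q_mat x l (n, m) *v u)"
      unfolding Q_form S_def by (simp add: u_def vector_4)
    then show ?thesis
      using Q by (simp add: symmetric_psd_def)
  qed
  have "0 \<le> Re (\<Sum>i\<in>UNIV. cnj (v $ i) * (P_mat x' r (n, m) *v v) $ i)" for v
  proof -
    (* The defect is real, so real and imaginary parts of (v_2, v_3) decouple. *)
    have defect: "r (n, m) - x' n * cnj (x' m) = of_real (l (n, m) - x n \<bullet> x m)"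
      by (simp add: r x' complex_eq_iff to_complex_def inner_vec_def sum_2)
    have norms: "(cmod (x' n))\<^sup>2 = x n \<bullet> x n" "(cmod (x' m))\<^sup>2 = x m \<bullet> x m"
      unfolding cmod_power2 x'
      by (simp_all add: to_complex_def inner_vec_def sum_2 power2_eq_square)
    have "Re (\<Sum>i\<in>UNIV. cnj (v $ i) * (P_mat x' r (n, m) *v v) $ i) =
        (cmod (v $ 1 + x' n * v $ 2 + x' m * v $ 3))\<^sup>2 +
        S (Re (v $ 2)) (Re (v $ 3)) + S (Im (v $ 2)) (Im (v $ 3))"
      \<comment> \<open>Only these two moduli are expanded, so that the leading square stays
        intact.\<close>
      unfolding P_form defect norms S_def cmod_power2[of "v $ 2"] cmod_power2[of "v $ 3"]
      by (simp add: algebra_simps)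
    then show ?thesis
      using S by simp
  qed
  then show ?thesis
    by (simp add: hermitian_psd_def conj_transpose_P_mat)
qed

theorem corollary6:
  fixes N :: nat and V :: "nat set" and E :: "(nat \<times> nat) set"
    and w :: "nat \<Rightarrow> real" and lam :: "nat \<times> nat \<Rightarrow> real" and y :: "nat \<Rightarrow> complex"
  assumes "V = {1..N}"
    and "E \<subseteq> {(n, m). n \<in> V \<and> m \<in> V \<and> n < m}"
    and "connected_graph V E"
    and "\<forall>n\<in>V. 0 < w n"
    and "\<forall>e\<in>E. 0 < lam e"
    and "\<forall>n\<in>V. cmod (y n) = 1"
  shows "(\<forall>x r. solves_A V E w lam y (x, r) \<longrightarrow>
             solves_B V E w lam y (\<lambda>n\<in>V. to_vec (x n), \<lambda>e\<in>E. Re (r e))) \<and>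
         (\<forall>x l. solves_B V E w lam y (x, l) \<longrightarrow>
             solves_A V E w lam y
               (\<lambda>n\<in>V. to_complex (x n),
                \<lambda>(n, m)\<in>E. Complex (l (n, m)) (Im (cnj (to_complex (x m)) * to_complex (x n)))))"
proof -
  \<comment> \<open>\<open>g\<close> need not undo \<open>f\<close>, since it resets the imaginary
    part of r. Preserving feasibility and objective values suffices.\<close>
  define f :: "(nat \<Rightarrow> complex) \<times> (nat \<times> nat \<Rightarrow> complex) \<Rightarrow> _"
    where "f = (\<lambda>(x, r). (\<lambda>n\<in>V. to_vec (x n), \<lambda>e\<in>E. Re (r e)))"
  define g :: "(nat \<Rightarrow> real ^ 2) \<times> (nat \<times> nat \<Rightarrow> real) \<Rightarrow> _"
    where "g = (\<lambda>(x, l). (\<lambda>n\<in>V. to_complex (x n),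
      \<lambda>(n, m)\<in>E. Complex (l (n, m)) (Im (cnj (to_complex (x m)) * to_complex (x n)))))"
  \<comment> \<open>With both endpoints in V, the restricted functions take their intended values
    there and not \<open>undefined\<close>.\<close>
  have E: "n \<in> V" "m \<in> V" if "(n, m) \<in> E" for n m
    using that assms(2) by auto
  have f: "f p \<in> feasible_B V E \<and> obj_K V E w lam y (f p) = obj_J V E w lam y p"
    if "p \<in> feasible_A V E" for p
  proof -
    obtain x r where p: "p = (x, r)" by (cases p)
    have "symmetric_psd (Q_mat (\<lambda>n\<in>V. to_vec (x n)) (\<lambda>e\<in>E. Re (r e)) (n, m))"
      if "(n, m) \<in> E" for n m
      using \<open>p \<in> feasible_A V E\<close> that E[OF that]
      by (intro symmetric_psd_Q_mat_of_P_mat[of x r]) (auto simp: p feasible_A_def)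
    then show ?thesis
      by (auto simp: p f_def feasible_B_def obj_J_def obj_K_def to_vec_inner)
  qed
  have g: "g q \<in> feasible_A V E \<and> obj_J V E w lam y (g q) = obj_K V E w lam y q"
    if "q \<in> feasible_B V E" for q
  proof -
    obtain x l where q: "q = (x, l)" by (cases q)
    have "hermitian_psd (P_mat (fst (g q)) (snd (g q)) (n, m))" if "(n, m) \<in> E" for n m
      using \<open>q \<in> feasible_B V E\<close> that E[OF that]
      by (intro hermitian_psd_P_mat_of_Q_mat[of x l]) (auto simp: q g_def feasible_B_def)
    moreover have "(\<Sum>e\<in>E. lam e * Re (snd (g q) e)) = (\<Sum>e\<in>E. lam e * l e)"
      by (rule sum.cong) (auto simp: q g_def)
    ultimately show ?thesis
      \<comment> \<open>Real parts of products stay unexpanded so that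
        \<open>Re_to_complex_mult_cnj\<close> can match.\<close>
      by (auto simp: q g_def feasible_A_def obj_J_def obj_K_def Re_to_complex_mult_cnj
          simp del: times_complex.sel)
  qed
  have "solves_B V E w lam y (f p)" if "solves_A V E w lam y p" for p
  proof -
    have "p \<in> feasible_A V E"
      using that by (simp add: solves_A_def is_arg_min_def)
    with that show ?thesis
      unfolding solves_A_def solves_B_def
      \<comment> \<open>Competitors for (B) are carried back to (A) by the opposite map.\<close>
      by (elim is_arg_min_transfer[where h = g]) (simp_all add: f g)
  qed
  moreover have "solves_A V E w lam y (g q)" if "solves_B V E w lam y q" for q
  proof -
    have "q \<in> feasible_B V E"
      using that by (simp add: solves_B_def is_arg_min_def)
    with that show ?thesis
      unfolding solves_A_def solves_B_def
      by (elim is_arg_min_transfer[where h = f]) (simp_all add: f g)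
  qed
  ultimately show ?thesis
    by (auto simp: f_def g_def)
qed

end
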